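(* Let $X=X(A,P)$ be a rational projective $\mathbb K^*$-surface with $P$ irredundant and assume that $X$ has fixed point curves $D^+$ and $D^-$. If $D^+$ admits a vertical $P$-root, then there is no vertical $P$-root at $D^-$.
   Context: $\mathbb K$ is an algebraically closed field of characteristic zero. A $\mathbb K^*$-surface is a normal irreducible surface with an effective morphical $\mathbb K^*$-action. The surface $X(A,P)$. Let $r\ge1$, $n_0,\dots,n_r\ge1$; $A=[a_0,\dots,a_r]$ a $2\times(r+1)$-matrix over $\mathbb K$ with pairwise linearly independent columns; $e_1,\dots,e_{r+1}$ the canonical basis of $\mathbb Z^{r+1}$ and $e_0:=-e_1-\dots-e_r$. $P$ is an integral matrix with columns $v_{ij}=l_{ij}e_i+d_{ij}e_{r+1}$ ($0\le i\le r$, $1\le j\le n_i$), $l_{ij}\ge1$, $\gcd(l_{ij},d_{ij})=1$, and, each optionally, $v^+=e_{r+1}$, $v^-=-e_{r+1}$; the columns are pairwise distinct and generate $\mathbb Q^{r+1}$ as a cone. With slopes $m_{ij}=d_{ij}/l_{ij}$, $P$ is slope ordered: $m_{i1}>\dots>m_{in_i}$. $P$ is irredundant if $l_{i1}n_i\ge2$ for all $i$. Let $\Sigma$ be the fan with maximal cones $\mathrm{cone}(v_{ij},v_{ij+1})$ ($1\le j<n_i$); $\mathrm{cone}(v^+,v_{i1})$ ($0\le i\le r$) if $v^+$ is present and $\mathrm{cone}(v_{01},\dots,v_{r1})$ otherwise; $\mathrm{cone}(v_{in_i},v^-)$ if $v^-$ is present and $\mathrm{cone}(v_{0n_0},\dots,v_{rn_r})$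 otherwise. Let $Z$ be its toric variety, with Cox coordinates $T_{ij},S^\pm$ and Cox quotient $p\colon\hat Z\to Z$, $\hat Z\subseteq\bar Z=\mathbb K^{\#\text{columns}}$. Then $X=X(A,P)=p(\bar X\cap\hat Z)\subseteq Z$, where $\bar X\subseteq\bar Z$ is the zero set of all $\det\begin{bmatrix}T_{i}^{l_{i}}&T_{j}^{l_{j}}&T_{k}^{l_{k}}\\ a_{i}&a_{j}&a_{k}\end{bmatrix}$, $0\le i<j<k\le r$, $T_i^{l_i}=\prod_jT_{ij}^{l_{ij}}$. $\mathbb K^*$ acts on $X$ via $t\cdot z=(z_1,\dots,z_r,tz_{r+1})$ on the acting torus of $Z$. The curve $D^+$ (resp. $D^-$) of fixed points exists iff $v^+$ (resp. $v^-$) is a column of $P$; it is cut out by the corresponding toric divisor of $Z$. Vertical $P$-roots. If there is a curve $D^+\subseteq X$, a vertical $P$-root at $D^+$ is $u\in\mathbb Z^r\times\mathbb Z_{<0}$ with $\langle u,v^+\rangle=-1$ and $\langle u,v_{i1}\rangle\ge0$ for $i=0,\dots,r$. If there is a curve $D^-\subseteq X$, a vertical $P$-root at $D^-$ is $u\in\mathbb Z^r\times\mathbb Z_{>0}$ with $\langle u,v^-\rangle=-1$ and $\langle u,v_{in_i}\rangle\ge0$ for $i=0,\dots,r$. *)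

theory Defs
  imports
    "HOL-Computational_Algebra.Polynomial"
    "HOL-Library.FuncSet"
    "Jordan_Normal_Form.Determinant"
begin

section \<open>The defining matrices\<close>

text \<open>
  The columns of the matrix $P$ are indexed by the following type; \<open>V i j\<close> stands for $v_{ij}$
  with $0 \le i \le r$ and $1 \le j \le n_i$. The same indices label the Cox coordinates
  $T_{ij}$, $S^+$, $S^-$.
\<close>

datatype col_index = V nat nat | Vplus | Vminus

record P_data =
  rk :: nat
  num :: "nat \<Rightarrow> nat"
  el :: "nat \<Rightarrow> nat \<Rightarrow> nat"
  de :: "nat \<Rightarrow> nat \<Rightarrow> int"
  has_plus :: bool
  has_minus :: bool

definition cols_of :: "P_data \<Rightarrow> col_index set" where
  "cols_of P = {V i j | i j. i \<le> rk P \<and> 1 \<le> j \<and> j \<le> num P i}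
     \<union> (if has_plus P then {Vplus} else {}) \<union> (if has_minus P then {Vminus} else {})"

text \<open>
  Vectors in $\mathbb Z^{r+1}$ are integral vectors of dimension \<open>Suc (rk P)\<close>. Their entries are
  numbered from 0, so $e_k$ is \<open>unit_vec (Suc (rk P)) (k - 1)\<close> and the last entry has
  index \<open>rk P\<close>.
\<close>

definition e_vec :: "P_data \<Rightarrow> nat \<Rightarrow> int vec" where
  "e_vec P i = (if i = 0 then vec (Suc (rk P)) (\<lambda>k. if k < rk P then - 1 else 0)
                else unit_vec (Suc (rk P)) (i - 1))"

fun P_col :: "P_data \<Rightarrow> col_index \<Rightarrow> int vec" where
  "P_col P (V i j) = int (el P i j) \<cdot>\<^sub>v e_vec P i + de P i j \<cdot>\<^sub>v e_vec P (Suc (rk P))"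
| "P_col P Vplus = e_vec P (Suc (rk P))"
| "P_col P Vminus = - e_vec P (Suc (rk P))"

definition slope :: "P_data \<Rightarrow> nat \<Rightarrow> nat \<Rightarrow> rat" where
  "slope P i j = of_int (de P i j) / of_nat (el P i j)"

definition generate_as_cone :: "P_data \<Rightarrow> bool" where
  "generate_as_cone P \<longleftrightarrow>
     (\<forall>w \<in> carrier_vec (Suc (rk P)). \<exists>q :: col_index \<Rightarrow> rat.
        (\<forall>c \<in> cols_of P. 0 \<le> q c) \<and>
        (\<forall>k < Suc (rk P). w $ k = (\<Sum>c \<in> cols_of P. q c * of_int (P_col P c $ k))))"

definition P_matrix :: "P_data \<Rightarrow> bool" where
  "P_matrix P \<longleftrightarrow>
     1 \<le> rk P \<and>
     (\<forall>i \<le> rk P. 1 \<le> num P i) \<and>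
     (\<forall>i j. V i j \<in> cols_of P \<longrightarrow> 1 \<le> el P i j \<and> coprime (int (el P i j)) (de P i j)) \<and>
     inj_on (P_col P) (cols_of P) \<and>
     generate_as_cone P \<and>
     (\<forall>i \<le> rk P. \<forall>j j'. 1 \<le> j \<and> j < j' \<and> j' \<le> num P i \<longrightarrow> slope P i j > slope P i j')"

definition A_matrix :: "P_data \<Rightarrow> 'k :: field mat \<Rightarrow> bool" where
  "A_matrix P A \<longleftrightarrow>
     A \<in> carrier_mat 2 (Suc (rk P)) \<and>
     (\<forall>i \<le> rk P. \<forall>j \<le> rk P. i \<noteq> j \<longrightarrow>
        (\<forall>x y. x \<cdot>\<^sub>v col A i + y \<cdot>\<^sub>v col A j = 0\<^sub>v 2 \<longrightarrow> x = 0 \<and> y = 0))"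

definition irredundant :: "P_data \<Rightarrow> bool" where
  "irredundant P \<longleftrightarrow> (\<forall>i \<le> rk P. 2 \<le> el P i 1 * num P i)"


section \<open>The ambient toric variety\<close>

text \<open>
  The maximal cones of the fan $\Sigma$, each given by the indices of its generators.
  All these cones are simplicial, and a column of $P$ lying in one of them is one of its generators.
\<close>

definition max_cones :: "P_data \<Rightarrow> col_index set set" where
  "max_cones P =
     {{V i j, V i (Suc j)} | i j. i \<le> rk P \<and> 1 \<le> j \<and> j < num P i}
     \<union> (if has_plus P then {{Vplus, V i 1} | i. i \<le> rk P}
        else {{V i 1 | i. i \<le> rk P}})
     \<union> (if has_minus P then {{V i (num P i), Vminus} | i. i \<le> rk P}
        else {{V i (num P i) | i. i \<le> rk P}})"

definition Z_bar :: "P_data \<Rightarrow> (col_index \<Rightarrow> 'k :: field) set" where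
  "Z_bar P = (\<Pi>\<^sub>E c \<in> cols_of P. UNIV)"

definition big_torus :: "P_data \<Rightarrow> (col_index \<Rightarrow> 'k :: field) set" where
  "big_torus P = (\<Pi>\<^sub>E c \<in> cols_of P. UNIV - {0})"

definition Z_hat :: "P_data \<Rightarrow> (col_index \<Rightarrow> 'k :: field) set" where
  "Z_hat P = {z \<in> Z_bar P. \<exists>\<sigma> \<in> max_cones P. {c \<in> cols_of P. z c = 0} \<subseteq> \<sigma>}"

text \<open>
  The homomorphism from the big torus onto the acting torus $(\mathbb K^*)^{r+1}$ of $Z$ given
  by $P$; its kernel is the characteristic quasitorus.
\<close>

definition torus_hom :: "P_data \<Rightarrow> (col_index \<Rightarrow> 'k :: field) \<Rightarrow> nat \<Rightarrow> 'k" where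
  "torus_hom P g = (\<lambda>k \<in> {..rk P}. \<Prod>c \<in> cols_of P. g c powi (P_col P c $ k))"

definition char_quasitorus :: "P_data \<Rightarrow> (col_index \<Rightarrow> 'k :: field) set" where
  "char_quasitorus P = {h \<in> big_torus P. torus_hom P h = (\<lambda>k \<in> {..rk P}. 1)}"

definition coord_mult ::
  "P_data \<Rightarrow> (col_index \<Rightarrow> 'k :: field) \<Rightarrow> (col_index \<Rightarrow> 'k) \<Rightarrow> col_index \<Rightarrow> 'k" where
  "coord_mult P g z = (\<lambda>c \<in> cols_of P. g c * z c)"

text \<open>
  Since $\Sigma$ is simplicial, the Cox quotient is geometric: the points of $Z$ are the orbits
  of the characteristic quasitorus in $\hat Z$, and $Z$ carries the quotient topology.
\<close>

definition cox_quotient ::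
  "P_data \<Rightarrow> (col_index \<Rightarrow> 'k :: field) \<Rightarrow> (col_index \<Rightarrow> 'k) set" where
  "cox_quotient P z = (\<lambda>h. coord_mult P h z) ` char_quasitorus P"

definition toric_divisor :: "P_data \<Rightarrow> col_index \<Rightarrow> (col_index \<Rightarrow> 'k :: field) set set" where
  "toric_divisor P c = cox_quotient P ` {z \<in> Z_hat P. c \<in> cols_of P \<and> z c = 0}"


section \<open>The surface $X(A,P)$ and its $\mathbb K^*$-action\<close>

definition T_monomial :: "P_data \<Rightarrow> (col_index \<Rightarrow> 'k :: field) \<Rightarrow> nat \<Rightarrow> 'k" where
  "T_monomial P z i = (\<Prod>j = 1..num P i. z (V i j) ^ el P i j)"

definition X_bar :: "'k :: field mat \<Rightarrow> P_data \<Rightarrow> (col_index \<Rightarrow> 'k) set" where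
  "X_bar A P = {z \<in> Z_bar P. \<forall>i j k. i < j \<and> j < k \<and> k \<le> rk P \<longrightarrow>
     det (mat_of_rows_list 3
       [[T_monomial P z i, T_monomial P z j, T_monomial P z k],
        [A $$ (0, i), A $$ (0, j), A $$ (0, k)],
        [A $$ (1, i), A $$ (1, j), A $$ (1, k)]]) = 0}"

definition X_surface :: "'k :: field mat \<Rightarrow> P_data \<Rightarrow> (col_index \<Rightarrow> 'k) set set" where
  "X_surface A P = cox_quotient P ` (X_bar A P \<inter> Z_hat P)"

text \<open>
  The element $t$ acts as the point $(1,\dots,1,t)$ of the acting torus of $Z$, that is, on Cox
  coordinates as multiplication by any lift of this point to the big torus. Collecting the results
  for all lifts and all representatives yields exactly one orbit of the characteristic quasitorus.
\<close>

definition K_action ::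
  "P_data \<Rightarrow> 'k :: field \<Rightarrow> (col_index \<Rightarrow> 'k) set \<Rightarrow> (col_index \<Rightarrow> 'k) set" where
  "K_action P t x = {coord_mult P g z | g z. z \<in> x \<and> g \<in> big_torus P \<and>
     torus_hom P g = (\<lambda>k \<in> {..rk P}. if k = rk P then t else 1)}"

definition fixed_points :: "'k :: field mat \<Rightarrow> P_data \<Rightarrow> (col_index \<Rightarrow> 'k) set set" where
  "fixed_points A P = {x \<in> X_surface A P. \<forall>t. t \<noteq> 0 \<longrightarrow> K_action P t x = x}"

text \<open>Polynomial functions in the Cox coordinates.\<close>

inductive_set poly_funs :: "P_data \<Rightarrow> ((col_index \<Rightarrow> 'k :: field) \<Rightarrow> 'k) set" for P where
  const: "(\<lambda>z. a) \<in> poly_funs P"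
| coord: "c \<in> cols_of P \<Longrightarrow> (\<lambda>z. z c) \<in> poly_funs P"
| add: "f \<in> poly_funs P \<Longrightarrow> g \<in> poly_funs P \<Longrightarrow> (\<lambda>z. f z + g z) \<in> poly_funs P"
| mult: "f \<in> poly_funs P \<Longrightarrow> g \<in> poly_funs P \<Longrightarrow> (\<lambda>z. f z * g z) \<in> poly_funs P"

text \<open>The Zariski topology of $X$: the quotient topology with respect to the Cox quotient.\<close>

definition closed_in_X ::
  "'k :: field mat \<Rightarrow> P_data \<Rightarrow> (col_index \<Rightarrow> 'k) set set \<Rightarrow> bool" where
  "closed_in_X A P C \<longleftrightarrow> C \<subseteq> X_surface A P \<and>
     (\<exists>F \<subseteq> poly_funs P. \<forall>z \<in> X_bar A P \<inter> Z_hat P.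
        cox_quotient P z \<in> C \<longleftrightarrow> (\<forall>f \<in> F. f z = 0))"

definition irreducible_closed ::
  "'k :: field mat \<Rightarrow> P_data \<Rightarrow> (col_index \<Rightarrow> 'k) set set \<Rightarrow> bool" where
  "irreducible_closed A P C \<longleftrightarrow> closed_in_X A P C \<and> C \<noteq> {} \<and>
     (\<forall>C1 C2. closed_in_X A P C1 \<and> closed_in_X A P C2 \<and> C = C1 \<union> C2 \<longrightarrow> C1 = C \<or> C2 = C)"

text \<open>A curve is an irreducible closed subset of Krull dimension one.\<close>

definition is_curve ::
  "'k :: field mat \<Rightarrow> P_data \<Rightarrow> (col_index \<Rightarrow> 'k) set set \<Rightarrow> bool" where
  "is_curve A P C \<longleftrightarrow> irreducible_closed A P C \<and>
     (\<exists>C0. irreducible_closed A P C0 \<and> C0 \<subset> C) \<and>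
     \<not> (\<exists>C0 C1. irreducible_closed A P C0 \<and> irreducible_closed A P C1 \<and> C0 \<subset> C1 \<and> C1 \<subset> C)"

definition fixed_point_curve ::
  "'k :: field mat \<Rightarrow> P_data \<Rightarrow> (col_index \<Rightarrow> 'k) set set \<Rightarrow> bool" where
  "fixed_point_curve A P C \<longleftrightarrow> is_curve A P C \<and> C \<subseteq> fixed_points A P"

text \<open>
  The candidates for the curves $D^+$ and $D^-$; they are empty, hence not curves, if the
  respective column is absent.
\<close>

definition D_plus :: "'k :: field mat \<Rightarrow> P_data \<Rightarrow> (col_index \<Rightarrow> 'k) set set" where
  "D_plus A P = X_surface A P \<inter> toric_divisor P Vplus"

definition D_minus :: "'k :: field mat \<Rightarrow> P_data \<Rightarrow> (col_index \<Rightarrow> 'k) set set" where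
  "D_minus A P = X_surface A P \<inter> toric_divisor P Vminus"


section \<open>Vertical $P$-roots\<close>

text \<open>
  These notions are only used if the curve $D^+$, respectively $D^-$, exists.
\<close>

definition vertical_P_root_plus :: "P_data \<Rightarrow> int vec \<Rightarrow> bool" where
  "vertical_P_root_plus P u \<longleftrightarrow>
     u \<in> carrier_vec (Suc (rk P)) \<and> u $ rk P < 0 \<and>
     u \<bullet> P_col P Vplus = - 1 \<and>
     (\<forall>i \<le> rk P. 0 \<le> u \<bullet> P_col P (V i 1))"

definition vertical_P_root_minus :: "P_data \<Rightarrow> int vec \<Rightarrow> bool" where
  "vertical_P_root_minus P u \<longleftrightarrow>
     u \<in> carrier_vec (Suc (rk P)) \<and> u $ rk P > 0 \<and>
     u \<bullet> P_col P Vminus = - 1 \<and>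
     (\<forall>i \<le> rk P. 0 \<le> u \<bullet> P_col P (V i (num P i)))"

end

theory Submission
  imports Defs
begin

text \<open>
  Put $u_0 = -u_1 - \dots - u_r$. A vertical root $u$ at $D^+$ satisfies $u_i \ge m_{i1}$ and a
  vertical root $w$ at $D^-$ satisfies $w_i \ge -m_{in_i}$ for $0 \le i \le r$. Hence
  $u_i + w_i \ge m_{i1} - m_{in_i} \ge 0$. These numbers add up to zero, so they all vanish. Thus
  $n_i = 1$, and $m_{i1} = u_i$ is an integer, so $l_{i1} = 1$ and $P$ is redundant.
\<close>

text \<open>Bilinearity, as \<open>e_vec P (Suc (rk P))\<close> picks out the last entry of
  \<open>u\<close>. Once that entry is known, a root condition becomes a bound comparing
  \<open>u \<bullet> e_vec P i\<close> with a slope.\<close>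

lemma scalar_prod_P_col:
  assumes "u \<in> carrier_vec (Suc (rk P))" "i \<le> rk P"
  shows "u \<bullet> P_col P (V i j) = int (el P i j) * (u \<bullet> e_vec P i) + de P i j * u $ rk P"
proof -
  have e: "e_vec P k \<in> carrier_vec (Suc (rk P))" for k
    by (simp add: e_vec_def)
  have "u \<bullet> e_vec P (Suc (rk P)) = u $ rk P"
    using assms by (simp add: e_vec_def)
  then show ?thesis
    using assms(1) e by (simp add: scalar_prod_add_distrib[of _ "Suc (rk P)"])
qed

text \<open>The vectors e_0, ..., e_r add up to zero by the choice of e_0.\<close>

lemma sum_scalar_prod_e_vec:
  assumes "u \<in> carrier_vec (Suc (rk P))"
  shows "(\<Sum>i\<le>rk P. u \<bullet> e_vec P i) = 0"
proof -
  have "u \<bullet> e_vec P 0 = - (\<Sum>k<rk P. u $ k)"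
    by (simp add: e_vec_def scalar_prod_def sum_negf atLeast0LessThan)
  \<comment> \<open>Entries are numbered from 0, so the unit vector e_{k+1} has its 1 at index
    k.\<close>
  moreover have "u \<bullet> e_vec P (Suc k) = u $ k" if "k < rk P" for k
    using that assms by (simp add: e_vec_def)
  ultimately show ?thesis
    by (simp add: sum.atMost_shift)
qed

lemma slope_last_le_first:
  assumes "P_matrix P" "i \<le> rk P"
  shows "slope P i (num P i) \<le> slope P i 1"
    and "slope P i (num P i) = slope P i 1 \<Longrightarrow> num P i = 1"
proof -
  have "1 \<le> num P i"
    using assms by (simp add: P_matrix_def)
  moreover have "slope P i (num P i) < slope P i 1" if "1 < num P i"
    using assms that unfolding P_matrix_def by blast
  ultimately have "num P i = 1 \<or> slope P i (num P i) < slope P i 1"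
    by linarith
  then show "slope P i (num P i) \<le> slope P i 1"
    and "slope P i (num P i) = slope P i 1 \<Longrightarrow> num P i = 1"
    by (elim disjE; simp)+
qed

lemma el_pos_coprime:
  assumes "P_matrix P" "i \<le> rk P" "1 \<le> j" "j \<le> num P i"
  shows "0 < el P i j" "coprime (int (el P i j)) (de P i j)"
proof -
  have "V i j \<in> cols_of P"
    using assms by (simp add: cols_of_def)
  then have "1 \<le> el P i j \<and> coprime (int (el P i j)) (de P i j)"
    using assms(1) unfolding P_matrix_def by blast
  then show "0 < el P i j" "coprime (int (el P i j)) (de P i j)"
    by simp_all
qed

text \<open>Clearing the positive denominator turns a comparison of rationals into one of integers,
  the form in which the root conditions are given.\<close>

lemma slope_le_of_int_iff:
  assumes "0 < el P i j"
  shows "slope P i j \<le> of_int a \<longleftrightarrow> de P i j \<le> int (el P i j) * a"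
proof -
  have "slope P i j \<le> of_int a \<longleftrightarrow> (of_int (de P i j) :: rat) \<le> of_int (int (el P i j) * a)"
    using assms by (simp add: slope_def field_simps)
  then show ?thesis
    by (simp only: of_int_le_iff)
qed

lemma of_int_le_slope_iff:
  assumes "0 < el P i j"
  shows "of_int a \<le> slope P i j \<longleftrightarrow> int (el P i j) * a \<le> de P i j"
proof -
  have "of_int a \<le> slope P i j \<longleftrightarrow> of_int (int (el P i j) * a) \<le> (of_int (de P i j) :: rat)"
    using assms by (simp add: slope_def field_simps)
  then show ?thesis
    by (simp only: of_int_le_iff)
qed

text \<open>Pairing to -1 with v^+ = e_{r+1} makes the last entry of \<open>u\<close> equal to -1,
  so nonnegativity on v_{i1} reads d_{i1} \<le> l_{i1} u_i.\<close>

lemma vertical_P_root_plus_ge: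
  assumes "P_matrix P" "vertical_P_root_plus P u" "i \<le> rk P"
  shows "slope P i 1 \<le> of_int (u \<bullet> e_vec P i)"
proof -
  have u: "u \<in> carrier_vec (Suc (rk P))"
    using assms(2) by (simp add: vertical_P_root_plus_def)
  have "u $ rk P = - 1"
    using assms(2) u by (simp add: vertical_P_root_plus_def e_vec_def)
  moreover have "0 \<le> u \<bullet> P_col P (V i 1)"
    using assms(2,3) by (simp add: vertical_P_root_plus_def)
  moreover have "1 \<le> num P i"
    using assms(1,3) by (simp add: P_matrix_def)
  ultimately show ?thesis
    using el_pos_coprime(1)[OF assms(1,3)] u assms(3)
    by (simp add: slope_le_of_int_iff scalar_prod_P_col del: P_col.simps)
qed

text \<open>Since v^- = -e_{r+1}, the last entry of \<open>w\<close> is now +1; with j = n_i the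
  condition reads -l_{ij} w_i \<le> d_{ij}.\<close>

lemma vertical_P_root_minus_ge:
  assumes "P_matrix P" "vertical_P_root_minus P w" "i \<le> rk P"
  shows "of_int (- (w \<bullet> e_vec P i)) \<le> slope P i (num P i)"
proof -
  have w: "w \<in> carrier_vec (Suc (rk P))"
    using assms(2) by (simp add: vertical_P_root_minus_def)
  have "w $ rk P = 1"
    using assms(2) w by (simp add: vertical_P_root_minus_def e_vec_def)
  moreover have "0 \<le> w \<bullet> P_col P (V i (num P i))"
    using assms(2,3) by (simp add: vertical_P_root_minus_def)
  moreover have "1 \<le> num P i"
    using assms(1,3) by (simp add: P_matrix_def)
  ultimately show ?thesis
    using el_pos_coprime(1)[OF assms(1,3)] w assms(3)
    by (simp add: of_int_le_slope_iff scalar_prod_P_col del: P_col.simps of_int_minus)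
qed

text \<open>An integral slope means that l_{ij} divides d_{ij}, and the two are coprime.\<close>

lemma el_eq_1_if_slope_integral:
  assumes "0 < el P i j" "coprime (int (el P i j)) (de P i j)" "slope P i j = of_int a"
  shows "el P i j = 1"
proof -
  have "de P i j = int (el P i j) * a"
    using assms(3) slope_le_of_int_iff[OF assms(1)] of_int_le_slope_iff[OF assms(1)]
    by (metis order.antisym order.refl)
  with assms(2) show ?thesis
    by simp
qed

theorem proposition9p18:
  fixes A :: "'k :: {alg_closed_field, field_char_0} mat" and P :: P_data
  assumes "P_matrix P" and "A_matrix P A"
    and "irredundant P"
    and "fixed_point_curve A P (D_plus A P)"
    and "fixed_point_curve A P (D_minus A P)"
    and "\<exists>u. vertical_P_root_plus P u"
  shows "\<not> (\<exists>w. vertical_P_root_minus P w)"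
proof
  assume "\<exists>w. vertical_P_root_minus P w"
  then obtain u w where u: "vertical_P_root_plus P u" and w: "vertical_P_root_minus P w"
    using assms(6) by blast
  define a b where "a i = u \<bullet> e_vec P i" and "b i = w \<bullet> e_vec P i" for i
  have ua: "slope P i 1 \<le> of_int (a i)" if "i \<le> rk P" for i
    using vertical_P_root_plus_ge[OF assms(1) u that] by (simp add: a_def)
  have wb: "of_int (- b i) \<le> slope P i (num P i)" if "i \<le> rk P" for i
    using vertical_P_root_minus_ge[OF assms(1) w that] by (simp add: b_def)
  have nonneg: "0 \<le> a i + b i" if "i \<le> rk P" for i
  proof -
    \<comment> \<open>The chain is -w_i \<le> m_{in_i} \<le> m_{i1} \<le> u_i.\<close>
    have "(of_int (- b i) :: rat) \<le> of_int (a i)"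
      using ua wb slope_last_le_first(1)[OF assms(1)] that by (meson order.trans)
    then show ?thesis
      by (simp only: of_int_le_iff)
  qed
  have "(\<Sum>i\<le>rk P. a i + b i) = 0"
    using u w
    by (simp add: a_def b_def sum.distrib sum_scalar_prod_e_vec
        vertical_P_root_plus_def vertical_P_root_minus_def)
  \<comment> \<open>A zero sum of nonnegative terms has only zero terms. The single index 0
    suffices, since irredundancy is required for every i.\<close>
  then have "a 0 + b 0 = 0"
    using nonneg sum_nonneg_eq_0_iff[of "{..rk P}" "\<lambda>i. a i + b i"] by simp
  then have "- b 0 = a 0"
    by simp
  \<comment> \<open>Both ends of the chain for i = 0 now agree, so all its inequalities are
    equalities.\<close>
  then have slopes: "slope P 0 1 = of_int (a 0)" "slope P 0 (num P 0) = slope P 0 1"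
    using ua[of 0] wb[of 0] slope_last_le_first(1)[OF assms(1), of 0] by auto
  then have n: "num P 0 = 1"
    using slope_last_le_first(2)[OF assms(1)] by simp
  have "el P 0 1 = 1"
    by (rule el_eq_1_if_slope_integral[OF _ _ slopes(1)]; rule el_pos_coprime[OF assms(1)])
      (simp_all add: n)
  \<comment> \<open>Here l_{01} n_0 = 1, while irredundancy demands at least 2.\<close>
  with n assms(3) show False
    by (auto simp: irredundant_def)
qed

end
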